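(* Let $N=\{u_1,\dots,u_n\}$ be a finite ground set whose elements arrive in a stream in the order $u_1,\dots,u_n$, let $f:2^N\to\mathbb{R}_{\ge 0}$ be a non-negative (not necessarily monotone) submodular function accessed through a value oracle, let $k\ge 1$ be an integer, let $\epsilon>0$, and let $\mathrm{OPT}=\max\{f(S): S\subseteq N,\ |S|\le k\}$. Suppose the input $m$ satisfies $m=\max_{u\in N} f(\{u\})$. Then the algorithm $\mathcal{A}_2(m)$ described in the context (with the unconstrained subroutine being a deterministic $1/2$-approximation algorithm for unconstrained non-negative submodular maximization) satisfies: (i) it outputs a set $S$ with $|S|\le k$ and $f(S)\ge (\frac16-\epsilon)\mathrm{OPT}$; (ii) it makes 1 pass over the data set, stores at most $O(\frac{k\log k}{\epsilon})$ elements, and has $O(\frac{\log k}{\epsilon})$ query complexity per element.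
   Context: Notation: $f(u\mid T)=f(T\cup\{u\})-f(T)$. Submodularity: $f(S)+f(T)\ge f(S\cup T)+f(S\cap T)$ for all $S,T\subseteq N$. Unconstrained subroutine: $\mathrm{Unconstrained}(A)$ is a deterministic algorithm that, given $A\subseteq N$, returns a set $T\subseteq A$ with $f(T)\ge \frac12\max_{T'\subseteq A} f(T')$. Algorithm $\mathcal{A}_2(m)$: let $Q=\{(1+\epsilon)^i: i\in\mathbb{Z},\ m\le (1+\epsilon)^i\le k m\}$. For each $v\in Q$ initialize $S_1^v=S_2^v=\emptyset$. For $j=1,\dots,n$, when $u_j$ arrives, for each $v\in Q$ with $\tau=v/6$: if $f(u_j\mid S_1^v)\ge \tau/k$ and $|S_1^v|<k$, add $u_j$ to $S_1^v$; else if $f(u_j\mid S_2^v)\ge \tau/k$ and $|S_2^v|<k$, add $u_j$ to $S_2^v$. After the stream ends, for each $v\in Q$ set $S_3^v=\mathrm{Unconstrained}(S_1^v)$, and return the set $S$ of largest $f$-value among all $S_1^v,S_2^v,S_3^v$, $v\in Q$.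
   Formalization: The ratio in (i) is not claimed when k=1, m>0 and no power of 1+ε equals m (Q is empty, so there is no candidate set); the O-bounds in (ii) are stated for k≥2 and ε≤1, since log 1=0 and 1/ε→0 for large ε make them fail otherwise. *)

theory Defs
  imports Complex_Main
begin

section \<open>Set functions\<close>

definition submodular_on :: "'a set \<Rightarrow> ('a set \<Rightarrow> real) \<Rightarrow> bool" where
  "submodular_on N f \<longleftrightarrow>
     (\<forall>S T. S \<subseteq> N \<longrightarrow> T \<subseteq> N \<longrightarrow> f S + f T \<ge> f (S \<union> T) + f (S \<inter> T))"

definition nonnegative_on :: "'a set \<Rightarrow> ('a set \<Rightarrow> real) \<Rightarrow> bool" where
  "nonnegative_on N f \<longleftrightarrow> (\<forall>S. S \<subseteq> N \<longrightarrow> 0 \<le> f S)"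

definition OPT :: "'a set \<Rightarrow> ('a set \<Rightarrow> real) \<Rightarrow> nat \<Rightarrow> real" where
  "OPT N f k = Max (f ` {S. S \<subseteq> N \<and> card S \<le> k})"


section \<open>Computations with access to a value oracle\<close>

text \<open>
  A computation never mentions the set function; it asks for the value of one set at a time, and
  the function is supplied only when the computation is run.
\<close>

datatype ('a, 'r) oracle_comp =
    Return 'r
  | Query "'a set" "real \<Rightarrow> ('a, 'r) oracle_comp"

primrec result :: "('a set \<Rightarrow> real) \<Rightarrow> ('a, 'r) oracle_comp \<Rightarrow> 'r" where
  "result f (Return r) = r"
| "result f (Query S c) = result f (c (f S))"

primrec queries :: "('a set \<Rightarrow> real) \<Rightarrow> ('a, 'r) oracle_comp \<Rightarrow> nat" where
  "queries f (Return r) = 0"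
| "queries f (Query S c) = Suc (queries f (c (f S)))"

primrec bind ::
  "('a, 'r) oracle_comp \<Rightarrow> ('r \<Rightarrow> ('a, 's) oracle_comp) \<Rightarrow> ('a, 's) oracle_comp" where
  "bind (Return r) g = g r"
| "bind (Query S c) g = Query S (\<lambda>x. bind (c x) g)"

primrec traverse ::
  "('b \<Rightarrow> ('a, 'c) oracle_comp) \<Rightarrow> 'b list \<Rightarrow> ('a, 'c list) oracle_comp" where
  "traverse g [] = Return []"
| "traverse g (x # xs) = bind (g x) (\<lambda>y. bind (traverse g xs) (\<lambda>ys. Return (y # ys)))"


section \<open>Streaming algorithms\<close>

text \<open>
  All information kept between two arrivals is in the state. At the end of a pass the state is
  post-processed; if the new state has an output the algorithm halts, otherwise the whole stream
  is read again. \<open>stored\<close> is the number of ground-set elements held in a state.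
\<close>

record ('a, 's, 'r) streaming_alg =
  start :: 's
  arrive :: "'a \<Rightarrow> 's \<Rightarrow> ('a, 's) oracle_comp"
  end_of_pass :: "'s \<Rightarrow> ('a, 's) oracle_comp"
  output_of :: "'s \<Rightarrow> 'r option"
  stored :: "'s \<Rightarrow> nat"

primrec pass_states ::
  "('a, 's, 'r) streaming_alg \<Rightarrow> ('a set \<Rightarrow> real) \<Rightarrow> 's \<Rightarrow> 'a list \<Rightarrow> 's list" where
  "pass_states A f s [] = [s]"
| "pass_states A f s (u # us) = s # pass_states A f (result f (arrive A u s)) us"

primrec pass_queries ::
  "('a, 's, 'r) streaming_alg \<Rightarrow> ('a set \<Rightarrow> real) \<Rightarrow> 's \<Rightarrow> 'a list \<Rightarrow> nat list" where
  "pass_queries A f s [] = []"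
| "pass_queries A f s (u # us) =
     queries f (arrive A u s) # pass_queries A f (result f (arrive A u s)) us"

text \<open>
  The record of a complete execution: the answer, the number of passes, the number of stored
  elements in every state visited, the number of queries made at every arrival, and the number of
  queries made at every end of a pass.
\<close>

record 'r execution =
  answer :: 'r
  passes :: nat
  memory_trace :: "nat list"
  arrival_queries :: "nat list"
  post_queries :: "nat list"

inductive executes ::
  "('a, 's, 'r) streaming_alg \<Rightarrow> ('a set \<Rightarrow> real) \<Rightarrow> 'a list \<Rightarrow> 's \<Rightarrow> 'r execution \<Rightarrow> bool"
  for A :: "('a, 's, 'r) streaming_alg" and f :: "'a set \<Rightarrow> real" and us :: "'a list" where
  halt:
    "\<lbrakk> t = last (pass_states A f s us); t' = result f (end_of_pass A t); output_of A t' = Some r \<rbrakk>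
     \<Longrightarrow> executes A f us s
           \<lparr> answer = r,
             passes = 1,
             memory_trace = map (stored A) (pass_states A f s us @ [t']),
             arrival_queries = pass_queries A f s us,
             post_queries = [queries f (end_of_pass A t)] \<rparr>"
| another_pass:
    "\<lbrakk> t = last (pass_states A f s us); t' = result f (end_of_pass A t); output_of A t' = None;
       executes A f us t' e \<rbrakk>
     \<Longrightarrow> executes A f us s
           \<lparr> answer = answer e,
             passes = Suc (passes e),
             memory_trace = map (stored A) (pass_states A f s us) @ memory_trace e,
             arrival_queries = pass_queries A f s us @ arrival_queries e,
             post_queries = queries f (end_of_pass A t) # post_queries e \<rparr>"

lemma executes_deterministic:
  "executes A f us s e \<Longrightarrow> executes A f us s e' \<Longrightarrow> e = e'"
proof (induction arbitrary: e' rule: executes.induct)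
  case (halt t s t' r)
  from halt.prems halt.hyps show ?case by (cases rule: executes.cases) auto
next
  case (another_pass t s t' e)
  from another_pass.prems show ?case
  proof (cases rule: executes.cases)
    case halt
    with another_pass.hyps show ?thesis by auto
  next
    case (another_pass t2 t2' e2)
    with \<open>t = _\<close> \<open>t' = _\<close> have "executes A f us t' e2" by simp
    then have "e = e2" by (rule \<open>\<And>e'. executes A f us t' e' \<Longrightarrow> e = e'\<close>)
    with another_pass \<open>t = _\<close> show ?thesis by simp
  qed
qed


section \<open>The unconstrained subroutine\<close>

definition unconstrained_half_approx ::
  "'a set \<Rightarrow> ('a set \<Rightarrow> real) \<Rightarrow> ('a set \<Rightarrow> ('a, 'a set) oracle_comp) \<Rightarrow> bool" where
  "unconstrained_half_approx N f U \<longleftrightarrow>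
     (\<forall>A. A \<subseteq> N \<longrightarrow>
        result f (U A) \<subseteq> A \<and> f (result f (U A)) \<ge> 1 / 2 * Max (f ` Pow A))"


section \<open>The algorithm\<close>

definition guesses :: "real \<Rightarrow> nat \<Rightarrow> real \<Rightarrow> real set" where
  "guesses \<epsilon> k m = {v. \<exists>i :: int. v = (1 + \<epsilon>) powi i \<and> m \<le> v \<and> v \<le> real k * m}"

definition marginal :: "'a \<Rightarrow> 'a set \<Rightarrow> ('a, real) oracle_comp" where
  "marginal u T = Query (T \<union> {u}) (\<lambda>x. Query T (\<lambda>y. Return (x - y)))"

text \<open>
  While the stream is read, the state holds the triples \<open>(v, S\<^sub>1, S\<^sub>2)\<close>; after post-processing it
  holds the quadruples \<open>(v, S\<^sub>1, S\<^sub>2, S\<^sub>3)\<close> and the set to be returned.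
\<close>

datatype 'a a2_state =
    Scanning "(real \<times> 'a set \<times> 'a set) list"
  | Finished "(real \<times> 'a set \<times> 'a set \<times> 'a set) list" "'a set"

definition a2_update ::
  "nat \<Rightarrow> 'a \<Rightarrow> real \<times> 'a set \<times> 'a set \<Rightarrow> ('a, real \<times> 'a set \<times> 'a set) oracle_comp" where
  "a2_update k u = (\<lambda>(v, S1, S2).
     let \<tau> = v / 6 in
     bind (marginal u S1) (\<lambda>g1.
       if g1 \<ge> \<tau> / real k \<and> card S1 < k then Return (v, S1 \<union> {u}, S2)
       else bind (marginal u S2) (\<lambda>g2.
         if g2 \<ge> \<tau> / real k \<and> card S2 < k then Return (v, S1, S2 \<union> {u})
         else Return (v, S1, S2))))"

primrec a2_arrive :: "nat \<Rightarrow> 'a \<Rightarrow> 'a a2_state \<Rightarrow> ('a, 'a a2_state) oracle_comp" where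
  "a2_arrive k u (Scanning L) = bind (traverse (a2_update k u) L) (\<lambda>L'. Return (Scanning L'))"
| "a2_arrive k u (Finished L S) = Return (Finished L S)"

primrec best_from :: "'a set \<Rightarrow> real \<Rightarrow> 'a set list \<Rightarrow> ('a, 'a set) oracle_comp" where
  "best_from S x [] = Return S"
| "best_from S x (T # Ts) = Query T (\<lambda>y. if x < y then best_from T y Ts else best_from S x Ts)"

text \<open>
  Ties go to the first maximiser. The empty set is returned if there are no candidates, that is, if
  there are no guesses.
\<close>

primrec best :: "'a set list \<Rightarrow> ('a, 'a set) oracle_comp" where
  "best [] = Return {}"
| "best (S # Ss) = Query S (\<lambda>x. best_from S x Ss)"

primrec a2_end ::
  "('a set \<Rightarrow> ('a, 'a set) oracle_comp) \<Rightarrow> 'a a2_state \<Rightarrow> ('a, 'a a2_state) oracle_comp" where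
  "a2_end U (Scanning L) =
     bind (traverse (\<lambda>(v, S1, S2). bind (U S1) (\<lambda>S3. Return (v, S1, S2, S3))) L) (\<lambda>L'.
     bind (best (concat (map (\<lambda>(v, S1, S2, S3). [S1, S2, S3]) L'))) (\<lambda>S.
     Return (Finished L' S)))"
| "a2_end U (Finished L S) = Return (Finished L S)"

primrec a2_output :: "'a a2_state \<Rightarrow> 'a set option" where
  "a2_output (Scanning L) = None"
| "a2_output (Finished L S) = Some S"

text \<open>
  An element occurring in several of the sets is counted once for each of them.
\<close>

primrec a2_stored :: "'a a2_state \<Rightarrow> nat" where
  "a2_stored (Scanning L) = (\<Sum>(v, S1, S2) \<leftarrow> L. card S1 + card S2)"
| "a2_stored (Finished L S) = (\<Sum>(v, S1, S2, S3) \<leftarrow> L. card S1 + card S2 + card S3) + card S"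

text \<open>
  \<open>sorted_list_of_set\<close> only fixes an order in which the guesses are processed; \<open>guesses \<epsilon> k m\<close> is
  finite whenever \<open>\<epsilon> > 0\<close> and \<open>m \<ge> 0\<close>, and it is empty for \<open>m = 0\<close>.
\<close>

definition A2 ::
  "real \<Rightarrow> nat \<Rightarrow> ('a set \<Rightarrow> ('a, 'a set) oracle_comp) \<Rightarrow> real
     \<Rightarrow> ('a, 'a a2_state, 'a set) streaming_alg" where
  "A2 \<epsilon> k U m =
     \<lparr> start = Scanning (map (\<lambda>v. (v, {}, {})) (sorted_list_of_set (guesses \<epsilon> k m))),
       arrive = a2_arrive k,
       end_of_pass = a2_end U,
       output_of = a2_output,
       stored = a2_stored \<rparr>"

end

(*
  Fix a guess v and put \<tau> = v/6. An accepted element raises the value of its set by at least \<tau>/k,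
  so a full set has value at least \<tau>. If neither S1 nor S2 fills up, write O for an optimal set
  and O' = O - S1. All of O' was rejected by S1 and all of O' - S2 by S2, so that
  f (S1 \<union> O) \<le> f S1 + \<tau> and f (S2 \<union> O') \<le> f S2 + \<tau>. As S1 and S2 are disjoint,
  (S1 \<union> O) \<inter> (S2 \<union> O') = O', and submodularity gives f O' \<le> f S1 + f S2 + 2\<tau>; the rest of O lies in
  S1, where S3 is half optimal. Altogether OPT \<le> f S1 + f S2 + 2 f S3 + 2\<tau>. Both cases yield the
  claimed ratio for every v within a factor 1 + \<epsilon> of OPT, on either side. The two-sided condition
  is needed: if OPT is close to m, the largest power below OPT may be less than m.
*)

theory Submission imports Defs begin

section \<open>Oracle computations\<close>

lemma result_bind [simp]: "result f (bind c g) = result f (g (result f c))"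
  by (induction c) auto

lemma queries_bind [simp]:
  "queries f (bind c g) = queries f c + queries f (g (result f c))"
  by (induction c) auto

lemma result_traverse [simp]: "result f (traverse g xs) = map (\<lambda>x. result f (g x)) xs"
  by (induction xs) auto

lemma queries_traverse [simp]: "queries f (traverse g xs) = (\<Sum>x\<leftarrow>xs. queries f (g x))"
  by (induction xs) auto

lemma result_marginal [simp]: "result f (marginal u T) = f (T \<union> {u}) - f T"
  by (simp add: marginal_def)

lemma queries_marginal [simp]: "queries f (marginal u T) = 2"
  by (simp add: marginal_def)

text \<open>The running value \<open>x\<close> is passed along instead of being queried again, so
  the link \<open>x = f S\<close> has to be restored at every recursive call.\<close>

lemma best_from_maximal:
  assumes "x = f S"
  shows "result f (best_from S x Ts) \<in> insert S (set Ts) \<and>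
    (\<forall>T\<in>insert S (set Ts). f T \<le> f (result f (best_from S x Ts)))"
  using assms
proof (induction Ts arbitrary: S x)
  case (Cons T Ts)
  show ?case
    using Cons.IH[of "f T" T] Cons.IH[of x S] Cons.prems by (auto intro: order_trans)
qed simp

lemma result_best_in: "Ss \<noteq> [] \<Longrightarrow> result f (best Ss) \<in> set Ss"
  using best_from_maximal[of _ f] by (cases Ss) auto

lemma result_best_ge: "S \<in> set Ss \<Longrightarrow> f S \<le> f (result f (best Ss))"
  using best_from_maximal[of _ f] by (cases Ss) auto

lemma queries_best_from: "queries f (best_from S x Ts) = length Ts"
  by (induction Ts arbitrary: S x) auto

lemma queries_best: "queries f (best Ss) = length Ss"
  by (cases Ss) (auto simp: queries_best_from)

text \<open>At most two marginals are evaluated, and \<open>marginal\<close> queries both of its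
  sets afresh, hence 2 * 2.\<close>

lemma queries_a2_update_le: "queries f (a2_update k u t) \<le> 4"
  by (cases t) (auto simp: a2_update_def Let_def)

lemma sum_list_map_le_length:
  fixes g :: "'b \<Rightarrow> nat"
  assumes "\<And>x. x \<in> set xs \<Longrightarrow> g x \<le> c"
  shows "(\<Sum>x\<leftarrow>xs. g x) \<le> c * length xs"
  using assms by (induction xs) (auto intro: add_mono)

section \<open>Submodular functions\<close>

lemma submodular_onD:
  "submodular_on N f \<Longrightarrow> S \<subseteq> N \<Longrightarrow> T \<subseteq> N \<Longrightarrow> f (S \<union> T) + f (S \<inter> T) \<le> f S + f T"
  by (simp add: submodular_on_def)

text \<open>Diminishing returns: submodularity for \<open>T\<close> and
  \<open>S \<union> {u}\<close>, whose intersection is \<open>S\<close> because \<open>u\<close>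
  lies outside \<open>T\<close>.\<close>

lemma submodular_marginal_antimono:
  assumes "submodular_on N f" "S \<subseteq> T" "T \<subseteq> N" "u \<in> N" "u \<notin> T"
  shows "f (T \<union> {u}) - f T \<le> f (S \<union> {u}) - f S"
proof -
  have "T \<union> (S \<union> {u}) = T \<union> {u}" "T \<inter> (S \<union> {u}) = S"
    using assms by auto
  moreover have "S \<subseteq> N" using assms by auto
  ultimately show ?thesis
    using submodular_onD[OF assms(1), of T "S \<union> {u}"] assms by auto
qed

text \<open>The elements of \<open>R\<close> are added one at a time; by diminishing returns none
  gains more than it would over \<open>S\<close> alone.\<close>

lemma submodular_Un_le:
  assumes sub: "submodular_on N f" and "S \<subseteq> N" and "finite R" "R \<subseteq> N" "R \<inter> S = {}"
    and marg: "\<And>u. u \<in> R \<Longrightarrow> f (S \<union> {u}) - f S \<le> c"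
  shows "f (S \<union> R) \<le> f S + real (card R) * c"
  using \<open>finite R\<close> \<open>R \<subseteq> N\<close> \<open>R \<inter> S = {}\<close> marg
proof (induction R)
  case (insert u R)
  have "f (S \<union> R \<union> {u}) - f (S \<union> R) \<le> f (S \<union> {u}) - f S"
    using insert.hyps insert.prems \<open>S \<subseteq> N\<close>
    by (intro submodular_marginal_antimono[OF sub]) auto
  also have "\<dots> \<le> c" using insert.prems by blast
  finally have "f (S \<union> insert u R) \<le> f (S \<union> R) + c" by simp
  moreover have "f (S \<union> R) \<le> f S + real (card R) * c"
    using insert by auto
  ultimately show ?case using insert.hyps by (simp add: algebra_simps)
qed simp

section \<open>The optimum and its range in terms of the best singleton\<close>

lemma OPT_attained:
  assumes "finite N"
  obtains A where "A \<subseteq> N" "card A \<le> k" "f A = OPT N f k"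
proof -
  have "OPT N f k \<in> f ` {S. S \<subseteq> N \<and> card S \<le> k}"
    unfolding OPT_def using assms by (intro Max_in) (auto intro: exI[of _ "{}"])
  then show ?thesis using that by auto
qed

lemma OPT_ge:
  assumes "finite N" "A \<subseteq> N" "card A \<le> k"
  shows "f A \<le> OPT N f k"
  unfolding OPT_def using assms by (intro Max_ge) auto

text \<open>Diminishing returns over the empty set bound the optimum by \<open>f {}\<close> plus at
  most \<open>k\<close> gains of \<open>m - f {}\<close>. The term \<open>f {}\<close> stays in the
  upper bound because a non-monotone \<open>f\<close> may be largest at the empty set.\<close>

lemma OPT_bounds:
  assumes fin: "finite N" "N \<noteq> {}" and sub: "submodular_on N f" and nn: "nonnegative_on N f"
    and k: "1 \<le> k" and m: "m = Max ((\<lambda>u. f {u}) ` N)"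
  shows "0 \<le> m" "m \<le> OPT N f k" "OPT N f k \<le> max (f {}) (real k * m)"
proof -
  have "m \<in> (\<lambda>u. f {u}) ` N" using m fin by simp
  then obtain u where u: "u \<in> N" "m = f {u}" by auto
  then show "0 \<le> m" using nn by (simp add: nonnegative_on_def)
  show "m \<le> OPT N f k" unfolding u(2) using u k fin by (intro OPT_ge) auto
  have f0: "0 \<le> f {}" using nn by (simp add: nonnegative_on_def)
  obtain A where A: "A \<subseteq> N" "card A \<le> k" "f A = OPT N f k"
    using OPT_attained[OF fin(1)] .
  have finA: "finite A" using A fin finite_subset by blast
  have "f {v} \<le> m" if "v \<in> N" for v using that m fin by simp
  then have le: "f A \<le> f {} + real (card A) * (m - f {})"
    using submodular_Un_le[OF sub, of "{}" A "m - f {}"] finA A by auto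
  show "OPT N f k \<le> max (f {}) (real k * m)"
  proof (cases "m \<le> f {} \<or> A = {}")
    case True
    then have "real (card A) * (m - f {}) \<le> 0" by (auto intro: mult_nonneg_nonpos)
    then show ?thesis using le A by simp
  next
    case False
    \<comment> \<open>With at least one element in \<open>A\<close>, the single \<open>f {}\<close>
      is cancelled by the \<open>card A\<close> copies subtracted in \<open>le\<close>.\<close>
    then have "1 \<le> real (card A)" using finA by (simp add: Suc_leI card_gt_0_iff)
    then have "f {} * 1 \<le> f {} * real (card A)" using f0 by (intro mult_left_mono)
    then have "f A \<le> real (card A) * m" using le by (simp add: algebra_simps)
    also have "\<dots> \<le> real k * m" using A \<open>0 \<le> m\<close> by (intro mult_right_mono) auto
    finally show ?thesis using A by simp
  qed
qed

section \<open>The guesses\<close>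

text \<open>Taking logarithms confines the exponents to an integer interval, from which both
  finiteness and the count of the guesses follow.\<close>

lemma guesses_subset:
  assumes "0 < \<epsilon>" "0 < m" "1 \<le> k"
  shows "guesses \<epsilon> k m \<subseteq>
    (\<lambda>i. (1 + \<epsilon>) powi i) ` {\<lceil>log (1 + \<epsilon>) m\<rceil>..\<lfloor>log (1 + \<epsilon>) (real k * m)\<rfloor>}"
proof
  fix v assume "v \<in> guesses \<epsilon> k m"
  then obtain i :: int where i: "v = (1 + \<epsilon>) powi i" "m \<le> v" "v \<le> real k * m"
    by (auto simp: guesses_def)
  have v: "v = (1 + \<epsilon>) powr real_of_int i" using assms i by (simp add: powr_real_of_int')
  have "log (1 + \<epsilon>) m \<le> log (1 + \<epsilon>) v" "log (1 + \<epsilon>) v \<le> log (1 + \<epsilon>) (real k * m)"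
    using assms i by simp_all
  moreover have "log (1 + \<epsilon>) v = real_of_int i" using v assms by simp
  ultimately show "v \<in> (\<lambda>i. (1 + \<epsilon>) powi i) `
      {\<lceil>log (1 + \<epsilon>) m\<rceil>..\<lfloor>log (1 + \<epsilon>) (real k * m)\<rfloor>}"
    using i by (auto simp: ceiling_le_iff le_floor_iff)
qed

lemma guesses_0:
  assumes "0 < \<epsilon>"
  shows "guesses \<epsilon> k 0 = {}"
proof -
  have "0 < (1 + \<epsilon>) powi i" for i :: int using assms by simp
  then show ?thesis unfolding guesses_def by (auto simp: not_le)
qed

lemma finite_guesses:
  assumes "0 < \<epsilon>" "0 \<le> m" "1 \<le> k"
  shows "finite (guesses \<epsilon> k m)"
proof (cases "m = 0")
  case False
  then show ?thesis using assms guesses_subset[of \<epsilon> m k] by (auto intro: finite_subset)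
qed (use assms guesses_0 in simp)

section \<open>The number of guesses\<close>

lemma half_le_ln_1_plus:
  fixes x :: real
  assumes "0 \<le> x" "x \<le> 1"
  shows "x / 2 \<le> ln (1 + x)"
proof -
  have "ln (1 / (1 + x)) \<le> 1 / (1 + x) - 1" using assms by (intro ln_le_minus_one) simp
  then have "x / (1 + x) \<le> ln (1 + x)" using assms by (simp add: ln_div field_simps)
  moreover have "x / 2 \<le> x / (1 + x)" using assms by (intro divide_left_mono) auto
  ultimately show ?thesis by linarith
qed

text \<open>The exponents fill an interval of length \<open>ln k / ln (1 + \<epsilon>)\<close>, at
  most \<open>2 * (ln k / \<epsilon>)\<close> because \<open>\<epsilon> \<le> 1\<close>. The one
  extra integer point is absorbed by the second claim, which rests on \<open>ln k \<ge> 1/2\<close>;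
  this gives 2 + 2 = 4.\<close>

lemma card_guesses_le:
  assumes "0 < \<epsilon>" "\<epsilon> \<le> 1" "0 \<le> m" "2 \<le> k"
  shows "real (card (guesses \<epsilon> k m)) \<le> 4 * (ln (real k) / \<epsilon>)"
    and "1 \<le> 2 * (ln (real k) / \<epsilon>)"
proof -
  have lnk: "1/2 \<le> ln (real k)"
  proof -
    have "1/2 \<le> ln (1 + 1::real)" by (rule half_le_ln_1_plus) auto
    also have "\<dots> \<le> ln (real k)" using assms by simp
    finally show ?thesis .
  qed
  have "\<epsilon> * 1 \<le> 1 * (2 * ln (real k))" using assms lnk by (intro mult_mono) auto
  then show one: "1 \<le> 2 * (ln (real k) / \<epsilon>)" using assms by (simp add: field_simps)
  show "real (card (guesses \<epsilon> k m)) \<le> 4 * (ln (real k) / \<epsilon>)"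
  proof (cases "m = 0")
    case True
    then show ?thesis using one guesses_0[of \<epsilon> k] assms by simp
  next
    case False
    then have m: "0 < m" using assms by simp
    define a b where "a = \<lceil>log (1 + \<epsilon>) m\<rceil>" and "b = \<lfloor>log (1 + \<epsilon>) (real k * m)\<rfloor>"
    have "card (guesses \<epsilon> k m) \<le> card ((\<lambda>i. (1 + \<epsilon>) powi i) ` {a..b})"
      unfolding a_def b_def using assms m by (intro card_mono guesses_subset) auto
    also have "\<dots> \<le> card {a..b}" by (rule card_image_le) simp
    also have "\<dots> = nat (b + 1 - a)" by simp
    finally have "real (card (guesses \<epsilon> k m)) \<le> max 0 (real_of_int b + 1 - real_of_int a)"
      by linarith
    also have "real_of_int b + 1 - real_of_int a \<le> 2 * (ln (real k) / \<epsilon>) + 1"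
    proof -
      have "real_of_int b - real_of_int a \<le> log (1 + \<epsilon>) (real k * m) - log (1 + \<epsilon>) m"
        unfolding a_def b_def by linarith
      also have "\<dots> = ln (real k) / ln (1 + \<epsilon>)"
        using assms m by (simp add: log_def ln_mult field_simps)
      also have "\<dots> \<le> ln (real k) / (\<epsilon> / 2)"
        using assms half_le_ln_1_plus[of \<epsilon>] lnk
        by (intro divide_left_mono) (auto intro: mult_pos_pos)
      finally show ?thesis by (simp add: mult.commute)
    qed
    finally have "real (card (guesses \<epsilon> k m)) \<le> max 0 (2 * (ln (real k) / \<epsilon>) + 1)"
      by simp
    then show ?thesis using one by linarith
  qed
qed

text \<open>The least power that is at least \<open>m\<close> exceeds it by a factor of at most
  \<open>1 + \<epsilon> \<le> 2 \<le> k\<close>.\<close>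

lemma guesses_nonempty:
  assumes "0 < \<epsilon>" "\<epsilon> \<le> 1" "0 < m" "2 \<le> k"
  shows "guesses \<epsilon> k m \<noteq> {}"
proof -
  define i where "i = \<lceil>log (1 + \<epsilon>) m\<rceil>"
  define v where "v = (1 + \<epsilon>) powr real_of_int i"
  have m: "m = (1 + \<epsilon>) powr log (1 + \<epsilon>) m" using assms by simp
  have "m \<le> v" unfolding v_def i_def by (subst m, rule powr_mono) (use assms in auto)
  moreover have "v \<le> (1 + \<epsilon>) powr (log (1 + \<epsilon>) m + 1)"
    unfolding v_def i_def using assms by (intro powr_mono) linarith+
  then have "v \<le> (1 + \<epsilon>) * m" using assms by (simp add: powr_add mult.commute)
  moreover have "(1 + \<epsilon>) * m \<le> real k * m" using assms by (intro mult_right_mono) auto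
  moreover have "v = (1 + \<epsilon>) powi i" using assms by (simp add: v_def powr_real_of_int')
  ultimately show ?thesis unfolding guesses_def by force
qed

text \<open>Round \<open>x\<close> up to a power of \<open>1 + \<epsilon>\<close>. If that leaves
  the window at the top, the preceding power is used, which explains the tolerance in both
  directions.\<close>

lemma guess_near:
  assumes \<epsilon>: "0 < \<epsilon>" and m: "0 < m" and x: "m \<le> x" "x \<le> real k * m"
    and ne: "guesses \<epsilon> k m \<noteq> {}"
  obtains v where "v \<in> guesses \<epsilon> k m" "v \<le> (1 + \<epsilon>) * x" "x \<le> (1 + \<epsilon>) * v"
proof -
  define i where "i = \<lceil>log (1 + \<epsilon>) x\<rceil>"
  define v where "v = (1 + \<epsilon>) powi i"
  have v: "v = (1 + \<epsilon>) powr real_of_int i" using \<epsilon> by (simp add: v_def powr_real_of_int')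
  have v0: "0 < v" using \<epsilon> by (simp add: v_def)
  have xp: "x = (1 + \<epsilon>) powr log (1 + \<epsilon>) x" using assms by simp
  have "x \<le> v" unfolding v i_def by (subst xp, rule powr_mono) (use assms in auto)
  have "v \<le> (1 + \<epsilon>) powr (log (1 + \<epsilon>) x + 1)"
    unfolding v i_def using assms by (intro powr_mono) linarith+
  then have vx: "v \<le> (1 + \<epsilon>) * x" using assms by (simp add: powr_add mult.commute)
  show thesis
  proof (cases "v \<le> real k * m")
    case True
    have "v \<le> (1 + \<epsilon>) * v" using \<epsilon> v0 by simp
    then have "x \<le> (1 + \<epsilon>) * v" using \<open>x \<le> v\<close> by simp
    moreover have "v \<in> guesses \<epsilon> k m"
      using True \<open>x \<le> v\<close> x v_def unfolding guesses_def by auto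
    ultimately show ?thesis using that vx by blast
  next
    case False
    define v' where "v' = (1 + \<epsilon>) powi (i - 1)"
    have v': "v = (1 + \<epsilon>) * v'" using \<epsilon> by (simp add: v_def v'_def power_int_diff)
    \<comment> \<open>Any existing guess lies below the overshooting \<open>v\<close>, hence at or
      below \<open>v'\<close>; so \<open>v'\<close> cannot fall under \<open>m\<close>.\<close>
    obtain j :: int where j: "m \<le> (1 + \<epsilon>) powi j" "(1 + \<epsilon>) powi j \<le> real k * m"
      using ne by (auto simp: guesses_def)
    have "j < i"
    proof (rule ccontr)
      assume "\<not> j < i"
      then have "v \<le> (1 + \<epsilon>) powi j" unfolding v_def using \<epsilon> by (intro power_int_increasing) auto
      then show False using j False by simp
    qed
    then have "(1 + \<epsilon>) powi j \<le> v'" unfolding v'_def using \<epsilon> by (intro power_int_increasing) auto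
    then have "m \<le> v'" using j by simp
    moreover have "v' \<le> x" using vx v' \<epsilon> by simp
    moreover have "x \<le> (1 + \<epsilon>) * x" using \<epsilon> m x by simp
    ultimately show ?thesis
      using that[of v'] x \<open>x \<le> v\<close> v' v'_def unfolding guesses_def by fastforce
  qed
qed

section \<open>The two sets kept for a guess\<close>

text \<open>\<open>P\<close> is the set of elements seen so far. The lower bounds start at
  \<open>f {}\<close>, which may be positive. Rejection is informative only while a set is not full,
  and elements accepted by \<open>S1\<close> are never tested against \<open>S2\<close>, so the last
  clause leaves them out.\<close>

definition a2_invariant ::
  "('a set \<Rightarrow> real) \<Rightarrow> nat \<Rightarrow> 'a set \<Rightarrow> real \<times> 'a set \<times> 'a set \<Rightarrow> bool" where
  "a2_invariant f k P = (\<lambda>(v, S1, S2).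
     S1 \<subseteq> P \<and> S2 \<subseteq> P \<and> S1 \<inter> S2 = {} \<and> card S1 \<le> k \<and> card S2 \<le> k \<and>
     f {} + real (card S1) * (v / 6 / real k) \<le> f S1 \<and>
     f {} + real (card S2) * (v / 6 / real k) \<le> f S2 \<and>
     (card S1 < k \<longrightarrow> (\<forall>u\<in>P - S1. f (S1 \<union> {u}) - f S1 \<le> v / 6 / real k)) \<and>
     (card S2 < k \<longrightarrow> (\<forall>u\<in>P - S1 - S2. f (S2 \<union> {u}) - f S2 \<le> v / 6 / real k)))"

lemma a2_invariant_init: "a2_invariant f k {} (v, {}, {})"
  by (simp add: a2_invariant_def)

lemma fst_result_a2_update [simp]: "fst (result f (a2_update k u t)) = fst t"
  by (cases t) (auto simp: a2_update_def Let_def)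

text \<open>A rejection recorded for a smaller set stays valid as the set grows, by diminishing
  returns; each acceptance adds at least one threshold to the value.\<close>

lemma a2_invariant_update:
  assumes sub: "submodular_on N f" and fin: "finite N" and P: "insert u P \<subseteq> N" "u \<notin> P"
    and inv: "a2_invariant f k P t"
  shows "a2_invariant f k (insert u P) (result f (a2_update k u t))"
proof -
  obtain v S1 S2 where t: "t = (v, S1, S2)" by (cases t)
  define c where "c = v / 6 / real k"
  note I = inv[unfolded t a2_invariant_def prod.case, folded c_def]
  have S: "S1 \<subseteq> P" "S2 \<subseteq> P" "S1 \<inter> S2 = {}" "u \<notin> S1" "u \<notin> S2" "finite S1" "finite S2"
    using I P fin finite_subset[of _ N] by auto
  have mono: "f (T \<union> {u} \<union> {w}) - f (T \<union> {u}) \<le> c"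
    if "T \<subseteq> P" "w \<in> P - T" "f (T \<union> {w}) - f T \<le> c" for T w
  proof -
    have "f (T \<union> {u} \<union> {w}) - f (T \<union> {u}) \<le> f (T \<union> {w}) - f T"
      using that P by (intro submodular_marginal_antimono[OF sub]) auto
    then show ?thesis using that by simp
  qed
  show ?thesis
  proof (cases "c \<le> f (S1 \<union> {u}) - f S1 \<and> card S1 < k")
    case True
    then have r: "result f (a2_update k u t) = (v, S1 \<union> {u}, S2)"
      by (simp add: t a2_update_def Let_def c_def)
    \<comment> \<open>\<open>S1\<close> was not full before \<open>u\<close> was added, so the
      earlier rejections are available from the invariant.\<close>
    have "\<forall>w\<in>insert u P - (S1 \<union> {u}). f (S1 \<union> {u} \<union> {w}) - f (S1 \<union> {u}) \<le> c"
      using mono[of S1] S I True by auto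
    then show ?thesis
      unfolding r a2_invariant_def prod.case c_def[symmetric]
      using I True S by (auto simp: algebra_simps)
  next
    case r1: False
    show ?thesis
    proof (cases "c \<le> f (S2 \<union> {u}) - f S2 \<and> card S2 < k")
      case True
      then have r: "result f (a2_update k u t) = (v, S1, S2 \<union> {u})"
        using r1 by (auto simp: t a2_update_def Let_def c_def)
      have "\<forall>w\<in>insert u P - S1 - (S2 \<union> {u}). f (S2 \<union> {u} \<union> {w}) - f (S2 \<union> {u}) \<le> c"
        using mono[of S2] S I True by auto
      then show ?thesis
        unfolding r a2_invariant_def prod.case c_def[symmetric]
        \<comment> \<open>\<open>r1\<close> supplies the clause for \<open>u\<close> against
          \<open>S1\<close>: if \<open>S1\<close> is not full, the gain of \<open>u\<close> was
          below the threshold.\<close>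
        using I True r1 S by (auto simp: algebra_simps)
    next
      case False
      then have r: "result f (a2_update k u t) = (v, S1, S2)"
        using r1 by (auto simp: t a2_update_def Let_def c_def)
      show ?thesis
        unfolding r a2_invariant_def prod.case c_def[symmetric]
        using I False r1 S by auto
    qed
  qed
qed

text \<open>The left alternative covers a full set. In the right one, 4 collects
  \<open>f S1\<close>, \<open>f S2\<close> and \<open>2 * f S3\<close>, and \<open>v / 3\<close> is
  the loss of two thresholds \<open>v / 6\<close>.\<close>

lemma a2_invariant_approx:
  assumes sub: "submodular_on N f" and nn: "nonnegative_on N f" and fin: "finite N"
    and k: "1 \<le> k" and v: "0 \<le> v" and inv: "a2_invariant f k N (v, S1, S2)"
    and S3: "f S3 \<ge> 1 / 2 * Max (f ` Pow S1)"
    and le: "f S1 \<le> x" "f S2 \<le> x" "f S3 \<le> x"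
  shows "v / 6 \<le> x \<or> OPT N f k \<le> 4 * x + v / 3"
proof -
  define c where "c = v / 6 / real k"
  have c: "0 \<le> c" "real k * c = v / 6" using v k by (auto simp: c_def)
  note I = inv[unfolded a2_invariant_def prod.case, folded c_def]
  have S: "S1 \<subseteq> N" "S2 \<subseteq> N" "S1 \<inter> S2 = {}" "finite S1"
    using I fin finite_subset[of _ N] by auto
  have f0: "0 \<le> f {}" using nn by (simp add: nonnegative_on_def)
  show ?thesis
  proof (cases "card S1 = k \<or> card S2 = k")
    case True
    then show ?thesis using I c f0 le by auto
  next
    case False
    then have less: "card S1 < k" "card S2 < k" using I by auto
    obtain A where A: "A \<subseteq> N" "card A \<le> k" "f A = OPT N f k"
      using OPT_attained[OF fin] .
    have finA: "finite A" using A fin finite_subset by blast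
    have small: "real (card R) * c \<le> v / 6" if "R \<subseteq> A" for R
    proof -
      have "card R \<le> k" using that A finA card_mono[of A R] by simp
      then have "real (card R) * c \<le> real k * c" using c by (intro mult_right_mono) auto
      then show ?thesis using c by simp
    qed
    have "f (S1 \<union> (A - S1)) \<le> f S1 + real (card (A - S1)) * c"
      using I less S A finA by (intro submodular_Un_le[OF sub]) auto
    then have 1: "f (S1 \<union> A) \<le> f S1 + v / 6" using small[of "A - S1"] by fastforce
    \<comment> \<open>Elements of \<open>A\<close> already in \<open>S2\<close> vanish in the union;
      what remains is exactly the range of the last clause of the invariant.\<close>
    have "f (S2 \<union> (A - S1 - S2)) \<le> f S2 + real (card (A - S1 - S2)) * c"
      using I less S A finA by (intro submodular_Un_le[OF sub]) auto
    then have 2: "f (S2 \<union> (A - S1)) \<le> f S2 + v / 6" using small[of "A - S1 - S2"] by fastforce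
    have "(S1 \<union> A) \<inter> (S2 \<union> (A - S1)) = A - S1" using S by auto
    moreover have "A - S1 \<subseteq> N" using A by auto
    \<comment> \<open>Nonnegativity, not monotonicity, is what allows the union term of
      submodularity to be dropped.\<close>
    moreover have "0 \<le> f (S1 \<union> A \<union> (S2 \<union> (A - S1)))"
      using nn S A unfolding nonnegative_on_def by (meson Diff_subset Un_least order_trans)
    ultimately have 3: "f (A - S1) \<le> f (S1 \<union> A) + f (S2 \<union> (A - S1))"
      using submodular_onD[OF sub, of "S1 \<union> A" "S2 \<union> (A - S1)"] S A by auto
    have "A \<inter> S1 \<union> (A - S1) = A" "A \<inter> S1 \<inter> (A - S1) = {}" by auto
    then have 4: "f A \<le> f (A \<inter> S1) + f (A - S1)"
      using submodular_onD[OF sub, of "A \<inter> S1" "A - S1"] A f0 by (simp add: le_infI1 Diff_subset[THEN order_trans])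
    have "f (A \<inter> S1) \<le> Max (f ` Pow S1)" using S by (intro Max_ge) auto
    then have "f (A \<inter> S1) \<le> 2 * f S3" using S3 by simp
    then show ?thesis using 1 2 3 4 le A by simp
  qed
qed

text \<open>The two alternatives use opposite sides of the tolerance. The first needs
  \<open>y \<le> (1 + \<epsilon>) * v\<close>, since
  \<open>(1/6 - \<epsilon>) * (1 + \<epsilon>) \<le> 1/6\<close>. The second needs
  \<open>v \<le> (1 + \<epsilon>) * y\<close> and gives
  \<open>x \<ge> y/6 - \<epsilon> * y/12\<close>, because (1 - 1/3) / 4 = 1/6.\<close>

lemma approx_ratio:
  fixes x y v \<epsilon> :: real
  assumes "v / 6 \<le> x \<or> y \<le> 4 * x + v / 3" "0 < \<epsilon>" "0 \<le> y"
    and "v \<le> (1 + \<epsilon>) * y" "y \<le> (1 + \<epsilon>) * v"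
  shows "(1 / 6 - \<epsilon>) * y \<le> x"
  using assms(1)
proof
  assume x: "v / 6 \<le> x"
  show ?thesis
  proof (cases "\<epsilon> \<le> 1/6")
    case True
    have "(1 / 6 - \<epsilon>) * y \<le> (1 / 6 - \<epsilon>) * ((1 + \<epsilon>) * v)"
      using True assms by (intro mult_left_mono) auto
    also have "\<dots> = v / 6 - (5 / 6 * \<epsilon> + \<epsilon> * \<epsilon>) * v" by (simp add: algebra_simps)
    also have "\<dots> \<le> v / 6"
    proof -
      have "0 \<le> v" using assms by (smt (verit) mult_nonneg_nonpos mult_pos_neg)
      then show ?thesis using assms by simp
    qed
    finally show ?thesis using x by simp
  next
    case False
    then have "(1 / 6 - \<epsilon>) * y \<le> 0" using assms by (intro mult_nonpos_nonneg) auto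
    moreover have "0 \<le> v" using assms by (smt (verit) mult_nonneg_nonpos mult_pos_neg)
    ultimately show ?thesis using x by simp
  qed
next
  assume "y \<le> 4 * x + v / 3"
  moreover have "0 \<le> \<epsilon> * y" using assms by simp
  moreover have "v \<le> y + \<epsilon> * y" using assms by (simp add: algebra_simps)
  ultimately have "y / 6 - \<epsilon> * y \<le> x" by linarith
  then show ?thesis by (simp add: algebra_simps)
qed

section \<open>A single pass\<close>

text \<open>\<open>P\<close> is the prefix already read, and distinctness of the stream makes each
  arrival new. For intermediate states some prefix suffices, as only the size bounds are needed
  there.\<close>

lemma a2_pass:
  assumes sub: "submodular_on N f" and fin: "finite N" and A: "arrive A = a2_arrive k"
    and "distinct us" "set us \<inter> P = {}" "P \<union> set us = N"
    and "\<forall>t\<in>set L. a2_invariant f k P t"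
  shows "\<exists>L'. last (pass_states A f (Scanning L) us) = Scanning L' \<and>
            map fst L' = map fst L \<and> (\<forall>t\<in>set L'. a2_invariant f k N t)"
    and "s \<in> set (pass_states A f (Scanning L) us) \<Longrightarrow>
           \<exists>L'. s = Scanning L' \<and> length L' = length L \<and>
             (\<forall>t\<in>set L'. \<exists>P. a2_invariant f k P t)"
    and "q \<in> set (pass_queries A f (Scanning L) us) \<Longrightarrow> q \<le> 4 * length L"
proof -
  have "(\<exists>L'. last (pass_states A f (Scanning L) us) = Scanning L' \<and>
            map fst L' = map fst L \<and> (\<forall>t\<in>set L'. a2_invariant f k N t)) \<and>
        (\<forall>s\<in>set (pass_states A f (Scanning L) us). \<exists>L'. s = Scanning L' \<and> length L' = length L \<and>
             (\<forall>t\<in>set L'. \<exists>P. a2_invariant f k P t)) \<and>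
        (\<forall>q\<in>set (pass_queries A f (Scanning L) us). q \<le> 4 * length L)"
    using assms(4-)
  proof (induction us arbitrary: P L)
    case Nil
    then show ?case by auto
  next
    case (Cons u us)
    define L' where "L' = map (\<lambda>t. result f (a2_update k u t)) L"
    have r: "result f (arrive A u (Scanning L)) = Scanning L'" by (simp add: A L'_def)
    have q: "queries f (arrive A u (Scanning L)) \<le> 4 * length L"
      by (simp add: A sum_list_map_le_length queries_a2_update_le)
    have ne: "pass_states A f s us \<noteq> []" for s by (cases us) auto
    have inv: "\<forall>t\<in>set L'. a2_invariant f k (insert u P) t"
    proof -
      have "insert u P \<subseteq> N" "u \<notin> P" using Cons.prems by auto
      then show ?thesis
        using Cons.prems(4) a2_invariant_update[OF sub fin] unfolding L'_def by auto
    qed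
    have L': "map fst L' = map fst L" "length L' = length L" by (simp_all add: L'_def)
    have "distinct us" "set us \<inter> insert u P = {}" "insert u P \<union> set us = N"
      using Cons.prems by auto
    note IH = Cons.IH[OF this inv]
    then show ?case using q L' Cons.prems(4) by (auto simp: r ne)
  qed
  then show "\<exists>L'. last (pass_states A f (Scanning L) us) = Scanning L' \<and>
            map fst L' = map fst L \<and> (\<forall>t\<in>set L'. a2_invariant f k N t)"
    and "s \<in> set (pass_states A f (Scanning L) us) \<Longrightarrow>
           \<exists>L'. s = Scanning L' \<and> length L' = length L \<and>
             (\<forall>t\<in>set L'. \<exists>P. a2_invariant f k P t)"
    and "q \<in> set (pass_queries A f (Scanning L) us) \<Longrightarrow> q \<le> 4 * length L"
    by blast+
qed

text \<open>Collects all facts about the unique run, with costs in terms of \<open>card Q\<close>.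
  Per guess, \<open>S1\<close>, \<open>S2\<close> and \<open>S3\<close> hold at most
  \<open>3 * k\<close> elements, and the answer adds \<open>k\<close>; the final stage spends
  \<open>B\<close> queries on the subroutine and three on comparing candidates.\<close>

lemma a2_execution:
  fixes us :: "'a list" and f :: "'a set \<Rightarrow> real"
  defines "N \<equiv> set us"
  assumes us: "distinct us" and sub: "submodular_on N f" and U: "unconstrained_half_approx N f U"
    and Q: "finite Q" "Q = guesses \<epsilon> k m"
  obtains e where
    "executes (A2 \<epsilon> k U m) f us (start (A2 \<epsilon> k U m)) e"
    "passes e = 1"
    "answer e \<subseteq> N" "card (answer e) \<le> k" "Q = {} \<Longrightarrow> answer e = {}"
    "\<And>v. v \<in> Q \<Longrightarrow> \<exists>S1 S2 S3. a2_invariant f k N (v, S1, S2) \<and> f S3 \<ge> 1 / 2 * Max (f ` Pow S1) \<and>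
       f S1 \<le> f (answer e) \<and> f S2 \<le> f (answer e) \<and> f S3 \<le> f (answer e)"
    "\<And>x. x \<in> set (memory_trace e) \<Longrightarrow> x \<le> 3 * k * card Q + k"
    "\<And>x. x \<in> set (arrival_queries e) \<Longrightarrow> x \<le> 4 * card Q"
    "\<And>x B. (\<And>A. A \<subseteq> N \<Longrightarrow> card A \<le> k \<Longrightarrow> queries f (U A) \<le> B) \<Longrightarrow>
       x \<in> set (post_queries e) \<Longrightarrow> x \<le> (B + 3) * card Q"
proof -
  define A where "A = A2 \<epsilon> k U m"
  define L0 :: "(real \<times> 'a set \<times> 'a set) list"
    where "L0 = map (\<lambda>v. (v, {}, {})) (sorted_list_of_set Q)"
  have sel: "start A = Scanning L0" "arrive A = a2_arrive k" "end_of_pass A = a2_end U"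
      "output_of A = a2_output" "stored A = a2_stored"
    by (simp_all add: A_def A2_def L0_def Q)
  have L0: "map fst L0 = sorted_list_of_set Q" "length L0 = card Q"
    by (simp_all add: L0_def o_def)
  have fin: "finite N" by (simp add: N_def)
  have "\<forall>t\<in>set L0. a2_invariant f k {} t" by (auto simp: L0_def a2_invariant_init)
  note pass = a2_pass[OF sub fin sel(2) us _ _ this, simplified, OF N_def[THEN meta_eq_to_obj_eq, symmetric]]
  obtain L where L: "last (pass_states A f (Scanning L0) us) = Scanning L"
      "map fst L = map fst L0" "\<forall>t\<in>set L. a2_invariant f k N t"
    using pass(1) by blast
  have lenL: "length L = card Q" using arg_cong[OF L(2), of length] L0 by simp
  \<comment> \<open>A pass never changes the guesses, so each one still has its pair of sets at the
    end.\<close>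
  have QL: "Q = fst ` set L" using arg_cong[OF L(2), of set] L0 Q by simp
  define L4 where "L4 = map (\<lambda>(v, S1, S2). (v, S1, S2, result f (U S1))) L"
  define Ss where "Ss = concat (map (\<lambda>(v, S1, S2, S3). [S1, S2, S3]) L4)"
  define S where "S = result f (best Ss)"
  have end_r: "result f (end_of_pass A (Scanning L)) = Finished L4 S"
    by (simp add: sel L4_def S_def Ss_def case_prod_unfold)
  have lenSs: "length Ss = 3 * card Q"
    using lenL by (simp add: Ss_def length_concat L4_def o_def case_prod_unfold sum_list_triv)
  have Lprop: "S1 \<subseteq> N" "S2 \<subseteq> N" "card S1 \<le> k" "card S2 \<le> k" "result f (U S1) \<subseteq> S1"
      "card (result f (U S1)) \<le> k" "f (result f (U S1)) \<ge> 1 / 2 * Max (f ` Pow S1)"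
    if "(v, S1, S2) \<in> set L" for v S1 S2
  proof -
    show *: "S1 \<subseteq> N" "S2 \<subseteq> N" "card S1 \<le> k" "card S2 \<le> k"
      using L(3) that by (auto simp: a2_invariant_def)
    show **: "result f (U S1) \<subseteq> S1" "f (result f (U S1)) \<ge> 1 / 2 * Max (f ` Pow S1)"
      using U * by (auto simp: unconstrained_half_approx_def)
    show "card (result f (U S1)) \<le> k"
      using ** * card_mono[of S1] fin finite_subset by (metis order_trans)
  qed
  have Ss: "set Ss = (\<Union>(v, S1, S2)\<in>set L. {S1, S2, result f (U S1)})"
    by (simp add: Ss_def L4_def case_prod_unfold)
  have Sprop: "S \<subseteq> N \<and> card S \<le> k"
  proof (cases "Ss = []")
    case True
    then show ?thesis by (simp add: S_def)
  next
    case False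
    then have "S \<in> set Ss" unfolding S_def by (rule result_best_in)
    then show ?thesis using Lprop unfolding Ss by fast
  qed
  define e where "e = \<lparr>answer = S, passes = 1,
      memory_trace = map (stored A) (pass_states A f (Scanning L0) us @ [Finished L4 S]),
      arrival_queries = pass_queries A f (Scanning L0) us,
      post_queries = [queries f (end_of_pass A (Scanning L))]\<rparr>"
  have "executes A f us (start A) e"
    unfolding e_def sel(1)
    using executes.halt[where A = A and f = f and us = us and s = "Scanning L0",
        OF refl refl, unfolded L(1) end_r]
    by (simp add: sel)
  moreover have "passes e = 1" "answer e \<subseteq> N" "card (answer e) \<le> k"
    using Sprop by (simp_all add: e_def)
  moreover have "answer e = {}" if "Q = {}"
    using that lenSs by (simp add: e_def S_def)
  moreover have "\<exists>S1 S2 S3. a2_invariant f k N (v, S1, S2) \<and> f S3 \<ge> 1 / 2 * Max (f ` Pow S1) \<and>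
       f S1 \<le> f (answer e) \<and> f S2 \<le> f (answer e) \<and> f S3 \<le> f (answer e)" if "v \<in> Q" for v
  proof -
    obtain S1 S2 where mem: "(v, S1, S2) \<in> set L" using \<open>v \<in> Q\<close> unfolding QL by auto
    then have "{S1, S2, result f (U S1)} \<subseteq> set Ss" unfolding Ss by fastforce
    then have "f S1 \<le> f S" "f S2 \<le> f S" "f (result f (U S1)) \<le> f S"
      unfolding S_def by (auto intro: result_best_ge)
    then show ?thesis using mem L(3) Lprop(7)[OF mem] by (auto simp: e_def)
  qed
  moreover have "x \<le> 3 * k * card Q + k" if "x \<in> set (memory_trace e)" for x
  proof -
    have "x \<in> stored A ` set (pass_states A f (Scanning L0) us) \<or> x = stored A (Finished L4 S)"
      using that by (auto simp: e_def)
    then show ?thesis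
    proof
      assume "x \<in> stored A ` set (pass_states A f (Scanning L0) us)"
      then obtain L' where x: "x = stored A (Scanning L')" "length L' = card Q"
          "\<forall>t\<in>set L'. \<exists>P. a2_invariant f k P t"
        using pass(2) L0 by force
      have "x \<le> (2 * k) * length L'"
        unfolding x(1) sel a2_stored.simps
        by (rule sum_list_map_le_length) (use x(3) in \<open>force simp: a2_invariant_def\<close>)
      also have "\<dots> \<le> 3 * k * card Q + k" using x(2) by simp
      finally show ?thesis .
    next
      assume x: "x = stored A (Finished L4 S)"
      have "(\<Sum>(v, S1, S2, S3) \<leftarrow> L4. card S1 + card S2 + card S3) \<le> (3 * k) * length L4"
        by (rule sum_list_map_le_length) (use Lprop in \<open>fastforce simp: L4_def\<close>)
      then show ?thesis using x Sprop lenL by (simp add: sel L4_def)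
    qed
  qed
  moreover have "x \<le> 4 * card Q" if "x \<in> set (arrival_queries e)" for x
    using pass(3) that L0 by (auto simp: e_def)
  moreover have "x \<le> (B + 3) * card Q"
    if B: "\<And>A. A \<subseteq> N \<Longrightarrow> card A \<le> k \<Longrightarrow> queries f (U A) \<le> B" and "x \<in> set (post_queries e)"
    for x B
  proof -
    have "x = (\<Sum>(v, S1, S2)\<leftarrow>L. queries f (U S1)) + length Ss"
      using that(2)
      by (simp add: e_def sel case_prod_unfold queries_best Ss_def L4_def)
    moreover have "(\<Sum>(v, S1, S2)\<leftarrow>L. queries f (U S1)) \<le> B * length L"
      by (rule sum_list_map_le_length) (use Lprop B in auto)
    ultimately show ?thesis using lenL lenSs by (simp add: algebra_simps)
  qed
  ultimately show thesis unfolding A_def by (rule that)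
qed

text \<open>For \<open>k = 1\<close> the window shrinks to the point \<open>m\<close>, which need
  not be a power of \<open>1 + \<epsilon>\<close>; the answer is then empty, so the ratio is
  conditional. The complexity bounds ask for \<open>k \<ge> 2\<close> since \<open>ln 1 = 0\<close>,
  and for \<open>\<epsilon> \<le> 1\<close> since one guess may survive while
  \<open>ln k / \<epsilon>\<close> tends to 0.\<close>

theorem theorem2:
  "\<exists>C > 0. \<forall>(us :: 'a list) (f :: 'a set \<Rightarrow> real) (k :: nat) (\<epsilon> :: real) (m :: real)
      (U :: 'a set \<Rightarrow> ('a, 'a set) oracle_comp).
     us \<noteq> [] \<longrightarrow> distinct us \<longrightarrow>
     nonnegative_on (set us) f \<longrightarrow> submodular_on (set us) f \<longrightarrow>
     1 \<le> k \<longrightarrow> 0 < \<epsilon> \<longrightarrow>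
     m = Max ((\<lambda>u. f {u}) ` set us) \<longrightarrow>
     unconstrained_half_approx (set us) f U \<longrightarrow>
     (\<exists>e. executes (A2 \<epsilon> k U m) f us (start (A2 \<epsilon> k U m)) e \<and>
        answer e \<subseteq> set us \<and> card (answer e) \<le> k \<and>
        (2 \<le> k \<or> m = 0 \<or> guesses \<epsilon> k m \<noteq> {} \<longrightarrow>
           f (answer e) \<ge> (1 / 6 - \<epsilon>) * OPT (set us) f k) \<and>
        passes e = 1 \<and>
        (2 \<le> k \<and> \<epsilon> \<le> 1 \<longrightarrow>
           (\<forall>x \<in> set (memory_trace e). real x \<le> C * (real k * ln (real k) / \<epsilon>)) \<and>
           (\<forall>q \<in> set (arrival_queries e). real q \<le> C * (ln (real k) / \<epsilon>)) \<and>
           (\<forall>B :: nat. (\<forall>A. A \<subseteq> set us \<and> card A \<le> k \<longrightarrow> queries f (U A) \<le> B) \<longrightarrow>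
              (\<forall>q \<in> set (post_queries e). real q \<le> C * (ln (real k) / \<epsilon>) * (1 + real B)))))"
proof (intro exI[of _ "16::real"] conjI allI impI)
  show "(0::real) < 16" by simp
next
  fix us :: "'a list" and f :: "'a set \<Rightarrow> real" and k :: nat and \<epsilon> m :: real
    and U :: "'a set \<Rightarrow> ('a, 'a set) oracle_comp"
  assume us: "us \<noteq> []" "distinct us" and nn: "nonnegative_on (set us) f"
    and sub: "submodular_on (set us) f" and k: "1 \<le> k" and \<epsilon>: "0 < \<epsilon>"
    and m: "m = Max ((\<lambda>u. f {u}) ` set us)" and U: "unconstrained_half_approx (set us) f U"
  define Q where "Q = guesses \<epsilon> k m"
  define opt where "opt = OPT (set us) f k"
  have ne: "set us \<noteq> {}" using us by simp
  note bounds = OPT_bounds[OF finite_set ne sub nn k m, folded opt_def]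
  have finQ: "finite Q" unfolding Q_def using \<epsilon> bounds k by (intro finite_guesses) auto
  obtain e where e:
    "executes (A2 \<epsilon> k U m) f us (start (A2 \<epsilon> k U m)) e"
    "passes e = 1"
    "answer e \<subseteq> set us" "card (answer e) \<le> k" "Q = {} \<Longrightarrow> answer e = {}"
    "\<And>v. v \<in> Q \<Longrightarrow> \<exists>S1 S2 S3. a2_invariant f k (set us) (v, S1, S2) \<and>
       f S3 \<ge> 1 / 2 * Max (f ` Pow S1) \<and>
       f S1 \<le> f (answer e) \<and> f S2 \<le> f (answer e) \<and> f S3 \<le> f (answer e)"
    "\<And>x. x \<in> set (memory_trace e) \<Longrightarrow> x \<le> 3 * k * card Q + k"
    "\<And>x. x \<in> set (arrival_queries e) \<Longrightarrow> x \<le> 4 * card Q"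
    "\<And>x B. (\<And>A. A \<subseteq> set us \<Longrightarrow> card A \<le> k \<Longrightarrow> queries f (U A) \<le> B) \<Longrightarrow>
       x \<in> set (post_queries e) \<Longrightarrow> x \<le> (B + 3) * card Q"
    using a2_execution[OF us(2) sub U finQ Q_def] by blast
  have pos: "0 \<le> v" if "v \<in> Q" for v
    using that bounds(1) by (auto simp: Q_def guesses_def)
  have f0: "0 \<le> f {}" using nn by (simp add: nonnegative_on_def)
  \<comment> \<open>This handles an optimum attained at the empty set, which the guesses need not
    approximate.\<close>
  have empty_le: "f {} \<le> f (answer e)"
  proof (cases "Q = {}")
    case False
    then obtain v where v: "v \<in> Q" by blast
    obtain S1 S2 where "a2_invariant f k (set us) (v, S1, S2)" "f S1 \<le> f (answer e)"
      using e(6)[OF v] by blast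
    then have "f {} + real (card S1) * (v / 6 / real k) \<le> f (answer e)"
      by (auto simp: a2_invariant_def)
    moreover have "0 \<le> real (card S1) * (v / 6 / real k)" using pos[OF v] by simp
    ultimately show ?thesis by linarith
  qed (use e(5) in simp)
  have opt0: "0 \<le> opt" using bounds by simp
  have ratio: "(1 / 6 - \<epsilon>) * opt \<le> f (answer e)" if cond: "2 \<le> k \<or> m = 0 \<or> Q \<noteq> {}"
  proof -
    \<comment> \<open>A nonpositive ratio and an optimum at the empty set are settled by
      \<open>empty_le\<close>; otherwise the optimum lies in the window from \<open>m\<close> to
      \<open>k * m\<close>.\<close>
    consider "1 / 6 \<le> \<epsilon>" | "opt \<le> f {}" | "\<epsilon> < 1 / 6" "f {} < opt" by linarith
    then show ?thesis
    proof cases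
      case 1
      then have "(1 / 6 - \<epsilon>) * opt \<le> 0" using opt0 by (intro mult_nonpos_nonneg) auto
      then show ?thesis using empty_le f0 by simp
    next
      case 2
      have "(1 / 6 - \<epsilon>) * opt \<le> 1 * opt" using opt0 \<epsilon> by (intro mult_right_mono) auto
      then show ?thesis using 2 empty_le by simp
    next
      case 3
      then have optk: "opt \<le> real k * m" using bounds by auto
      have m0: "0 < m"
      proof (rule ccontr)
        assume "\<not> 0 < m"
        then have "m = 0" using bounds by simp
        then show False using optk 3 f0 by simp
      qed
      \<comment> \<open>The option \<open>m = 0\<close> is excluded by \<open>m0\<close>; for
        \<open>k \<ge> 2\<close>, the bound \<open>\<epsilon> < 1/6\<close> makes
        \<open>guesses_nonempty\<close> applicable.\<close>
      have "Q \<noteq> {}" using cond m0 3 \<epsilon> guesses_nonempty[of \<epsilon> m k] unfolding Q_def by auto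
      then obtain v where v: "v \<in> Q" "v \<le> (1 + \<epsilon>) * opt" "opt \<le> (1 + \<epsilon>) * v"
        using guess_near[OF \<epsilon> m0 bounds(2) optk] unfolding Q_def by blast
      obtain S1 S2 S3 where S: "a2_invariant f k (set us) (v, S1, S2)"
        "f S3 \<ge> 1 / 2 * Max (f ` Pow S1)"
        "f S1 \<le> f (answer e)" "f S2 \<le> f (answer e)" "f S3 \<le> f (answer e)"
        using e(6)[OF v(1)] by blast
      have "v / 6 \<le> f (answer e) \<or> opt \<le> 4 * f (answer e) + v / 3"
        unfolding opt_def
        using a2_invariant_approx[OF sub nn finite_set k pos[OF v(1)] S] .
      then show ?thesis using approx_ratio \<epsilon> opt0 v by blast
    qed
  qed
  have complexity: "(\<forall>x \<in> set (memory_trace e). real x \<le> 16 * (real k * ln (real k) / \<epsilon>)) \<and>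
           (\<forall>q \<in> set (arrival_queries e). real q \<le> 16 * (ln (real k) / \<epsilon>)) \<and>
           (\<forall>B :: nat. (\<forall>A. A \<subseteq> set us \<and> card A \<le> k \<longrightarrow> queries f (U A) \<le> B) \<longrightarrow>
              (\<forall>q \<in> set (post_queries e). real q \<le> 16 * (ln (real k) / \<epsilon>) * (1 + real B)))"
    if "2 \<le> k" "\<epsilon> \<le> 1"
  proof -
    define l where "l = ln (real k) / \<epsilon>"
    have l: "real (card Q) \<le> 4 * l" "1 \<le> 2 * l"
      unfolding l_def Q_def using card_guesses_le[OF \<epsilon> that(2) bounds(1) that(1)] .
    have "real x \<le> 16 * (real k * l)" if "x \<in> set (memory_trace e)" for x
    proof -
      have "real x \<le> real (3 * k * card Q + k)" using e(7)[OF that] by (rule of_nat_mono)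
      also have "\<dots> = real k * (3 * real (card Q) + 1)" by (simp add: algebra_simps)
      \<comment> \<open>The bounds in \<open>l\<close> give 3 * 4 + 2 = 14 here; the constant 16
        comes from 4 queries for each of at most \<open>4 * l\<close> guesses.\<close>
      also have "\<dots> \<le> real k * (16 * l)" using l by (intro mult_left_mono) auto
      finally show ?thesis by simp
    qed
    moreover have "real x \<le> 16 * l" if "x \<in> set (arrival_queries e)" for x
      using of_nat_mono[OF e(8)[OF that], where 'a = real] l by simp
    moreover have "real x \<le> 16 * l * (1 + real B)"
      if B: "\<forall>A. A \<subseteq> set us \<and> card A \<le> k \<longrightarrow> queries f (U A) \<le> B"
        and x: "x \<in> set (post_queries e)" for x B
    proof -
      have "x \<le> (B + 3) * card Q" using B x by (intro e(9)) auto
      then have "real x \<le> real ((B + 3) * card Q)" by (rule of_nat_mono)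
      also have "\<dots> = (real B + 3) * real (card Q)" by simp
      also have "\<dots> \<le> (4 * (1 + real B)) * (4 * l)" using l by (intro mult_mono) auto
      finally show ?thesis by (simp add: algebra_simps)
    qed
    ultimately show ?thesis unfolding l_def by simp
  qed
  show "\<exists>e. executes (A2 \<epsilon> k U m) f us (start (A2 \<epsilon> k U m)) e \<and>
        answer e \<subseteq> set us \<and> card (answer e) \<le> k \<and>
        (2 \<le> k \<or> m = 0 \<or> guesses \<epsilon> k m \<noteq> {} \<longrightarrow>
           f (answer e) \<ge> (1 / 6 - \<epsilon>) * OPT (set us) f k) \<and>
        passes e = 1 \<and>
        (2 \<le> k \<and> \<epsilon> \<le> 1 \<longrightarrow>
           (\<forall>x \<in> set (memory_trace e). real x \<le> 16 * (real k * ln (real k) / \<epsilon>)) \<and>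
           (\<forall>q \<in> set (arrival_queries e). real q \<le> 16 * (ln (real k) / \<epsilon>)) \<and>
           (\<forall>B :: nat. (\<forall>A. A \<subseteq> set us \<and> card A \<le> k \<longrightarrow> queries f (U A) \<le> B) \<longrightarrow>
              (\<forall>q \<in> set (post_queries e). real q \<le> 16 * (ln (real k) / \<epsilon>) * (1 + real B))))"
    using e(1-4) ratio complexity unfolding Q_def opt_def by blast
qed

end
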